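(* Let $d\ge 2$, $D=\{1,\dots,d\}$, and let $\lambda=\lambda_1\otimes\cdots\otimes\lambda_d$ be a product of finite, positive, nonzero measures on $\Omega=\Omega_1\times\cdots\times\Omega_d$. For any $f_\mu\in\mathcal{B}^2(\lambda)$, \[ f_\mu=f_{\mu,\mathrm{ind}}\oplus\bigoplus_{I\subseteq D,\ |I|\ge2}f_{\mu,I,\mathrm{int}}, \] where the independence and interaction parts are respectively given by \[ f_{\mu,\mathrm{ind}}=\bigoplus_{i=1}^d f_{\mu,i},\qquad f_{\mu,I,\mathrm{int}}=\bigoplus_{J\subseteq I,\ J\ne\varnothing}\{(-1)^{|I\setminus J|}\}\odot f_{\mu,J}. \]
   Context: Bayes space. For a finite, positive, nonzero measure $\lambda$ on a measurable space $(\Omega,\mathcal{A})$, $\mathcal{M}(\lambda)$ is the set of $\sigma$-finite positive measures $\mu$ on $(\Omega,\mathcal A)$ with the same null sets as $\lambda$; $\mu$ is identified with its $\lambda$-density $f_\mu=d\mu/d\lambda$. Write $f_\mu\propto f_\nu$ if $f_\mu=c f_\nu$ ($\lambda$-a.e.) for some $c\in(0,\infty)$. The Bayes space is $\mathcal{B}(\lambda)=\mathcal{M}(\lambda)/\!\propto$; equality of elements means $\propto$. Vector space operations: $f\oplus g\propto fg$, $\alpha\odot f\propto f^{\alpha}$; the neutral element is the constant density $1$. $\mathcal{B}^2(\lambda)=\{f\in\mathcal{B}(\lambda):\int_\Omega|\ln f|^2d\lambda<\infty\}$. Product setting. For $i\in D$, $(\Omega_i,\mathcal{A}_i,\lambda_i)$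 is a measurable space with a finite, positive, nonzero measure; $\Omega=\prod_{i\in D}\Omega_i$, $\mathcal A=\bigotimes_{i\in D}\mathcal A_i$, $\lambda=\bigotimes_{i\in D}\lambda_i$; $\Omega_I,\lambda_I$ are the corresponding products over $i\in I$. Geometric margins. For non-empty $I\subsetneq D$, $f_{\mu,I}\propto\exp\{\frac{1}{\lambda_{D\setminus I}(\Omega_{D\setminus I})}\int_{\Omega_{D\setminus I}}\ln(f_\mu)\,d\lambda_{D\setminus I}\}$; $f_{\mu,D}=f_\mu$; $f_{\mu,i}=f_{\mu,\{i\}}$. *)

theory Defs
  imports "HOL-Analysis.Analysis" "HOL-Algebra.Module"
begin

section \<open>Bayes spaces\<close>

definition bayes_measures :: "'a measure \<Rightarrow> 'a measure set" where
  "bayes_measures L =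
     {\<mu>. sets \<mu> = sets L \<and> sigma_finite_measure \<mu> \<and> null_sets \<mu> = null_sets L}"

text \<open>Real-valued versions of the Radon--Nikodym densities of the measures in
  \<^term>\<open>bayes_measures L\<close>. Membership forces positivity almost everywhere; the values on
  null sets (where a version may even be negative) are irrelevant.\<close>

definition bayes_densities :: "'a measure \<Rightarrow> ('a \<Rightarrow> real) set" where
  "bayes_densities L =
     {f \<in> borel_measurable L. density L (\<lambda>x. ennreal (f x)) \<in> bayes_measures L}"

definition bayes_prop :: "'a measure \<Rightarrow> (('a \<Rightarrow> real) \<times> ('a \<Rightarrow> real)) set" where
  "bayes_prop L =
     {(f, g). f \<in> bayes_densities L \<and> g \<in> bayes_densities L \<and>
              (\<exists>c>0. AE x in L. f x = c * g x)}"

text \<open>The Bayes space as a real vector space on the proportionality classes. Its addition and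
  scalar multiplication are the perturbation and the powering of densities. The multiplicative
  fields belong to the record type only and are not used.\<close>

definition bayes_space :: "'a measure \<Rightarrow> (real, ('a \<Rightarrow> real) set) module" where
  "bayes_space L =
     \<lparr>carrier = bayes_densities L // bayes_prop L,
      monoid.mult = undefined, one = undefined,
      zero = bayes_prop L `` {\<lambda>x. 1},
      add = (\<lambda>F G. \<Union>f\<in>F. \<Union>g\<in>G. bayes_prop L `` {\<lambda>x. f x * g x}),
      smult = (\<lambda>\<alpha> F. \<Union>f\<in>F. bayes_prop L `` {\<lambda>x. f x powr \<alpha>})\<rparr>"

definition bayes_space2 :: "'a measure \<Rightarrow> ('a \<Rightarrow> real) set set" where
  "bayes_space2 L =
     {F \<in> carrier (bayes_space L).
        \<exists>f\<in>F. (\<integral>\<^sup>+ x. ennreal (\<bar>ln (f x)\<bar>\<^sup>2) \<partial>L) < \<infinity>}"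


section \<open>Geometric margins and interaction parts\<close>

text \<open>As \<^term>\<open>merge I (D - I) (x, y)\<close> uses only the coordinates of \<open>x\<close> in \<open>I\<close>, the same formula
  gives the margin as a density on the product over \<open>I\<close> and, as a function of \<open>x\<^sub>I\<close>, on
  the full product over \<open>D\<close>.\<close>

definition geo_margin_density ::
  "'i set \<Rightarrow> ('i \<Rightarrow> 'a measure) \<Rightarrow> 'i set \<Rightarrow> (('i \<Rightarrow> 'a) \<Rightarrow> real) \<Rightarrow> ('i \<Rightarrow> 'a) \<Rightarrow> real" where
  "geo_margin_density D lam I f =
     (if I = D then f
      else (\<lambda>x. exp (1 / measure (PiM (D - I) lam) (space (PiM (D - I) lam)) *
                     (\<integral>y. ln (f (merge I (D - I) (x, y))) \<partial>(PiM (D - I) lam)))))"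

definition geo_margin ::
  "'i set \<Rightarrow> ('i \<Rightarrow> 'a measure) \<Rightarrow> (('i \<Rightarrow> 'a) \<Rightarrow> real) set \<Rightarrow> 'i set \<Rightarrow> (('i \<Rightarrow> 'a) \<Rightarrow> real) set" where
  "geo_margin D lam F I =
     (\<Union>f\<in>F. bayes_prop (PiM D lam) `` {geo_margin_density D lam I f})"

definition ind_part ::
  "'i set \<Rightarrow> ('i \<Rightarrow> 'a measure) \<Rightarrow> (('i \<Rightarrow> 'a) \<Rightarrow> real) set \<Rightarrow> (('i \<Rightarrow> 'a) \<Rightarrow> real) set" where
  "ind_part D lam F = (\<Oplus>\<^bsub>bayes_space (PiM D lam)\<^esub> i\<in>D. geo_margin D lam F {i})"

definition int_part ::
  "'i set \<Rightarrow> ('i \<Rightarrow> 'a measure) \<Rightarrow> (('i \<Rightarrow> 'a) \<Rightarrow> real) set \<Rightarrow> 'i set \<Rightarrow> (('i \<Rightarrow> 'a) \<Rightarrow> real) set" where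
  "int_part D lam F I =
     (\<Oplus>\<^bsub>bayes_space (PiM D lam)\<^esub> J\<in>{J. J \<subseteq> I \<and> J \<noteq> {}}.
        ((-1) ^ card (I - J)) \<odot>\<^bsub>bayes_space (PiM D lam)\<^esub> geo_margin D lam F J)"


section \<open>Well-definedness of the vector space structure\<close>

lemma bayes_densities_iff:
  assumes "finite_measure L"
  shows "f \<in> bayes_densities L \<longleftrightarrow> f \<in> borel_measurable L \<and> (AE x in L. 0 < f x)"
proof -
  interpret finite_measure L by fact
  have sf: "sigma_finite_measure (density L (\<lambda>x. ennreal (f x)))"
    if "f \<in> borel_measurable L"
    using that by (subst sigma_finite_iff_density_finite) auto
  have "null_sets (density L (\<lambda>x. ennreal (f x))) = null_sets L \<longleftrightarrow> (AE x in L. 0 < f x)"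
    if f[measurable]: "f \<in> borel_measurable L"
  proof
    assume eq: "null_sets (density L (\<lambda>x. ennreal (f x))) = null_sets L"
    have "{x \<in> space L. f x \<le> 0} \<in> null_sets (density L (\<lambda>x. ennreal (f x)))"
      by (subst null_sets_density_iff) (auto simp: ennreal_neg)
    then have "{x \<in> space L. f x \<le> 0} \<in> null_sets L"
      by (simp add: eq)
    then show "AE x in L. 0 < f x"
      by (rule AE_I') auto
  next
    assume pos: "AE x in L. 0 < f x"
    have "A \<in> null_sets (density L (\<lambda>x. ennreal (f x))) \<longleftrightarrow> A \<in> null_sets L" for A
    proof -
      have "(AE x in L. x \<in> A \<longrightarrow> ennreal (f x) = 0) \<longleftrightarrow> (AE x in L. x \<notin> A)"
      proof
        assume "AE x in L. x \<in> A \<longrightarrow> ennreal (f x) = 0"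
        then show "AE x in L. x \<notin> A"
          using pos by eventually_elim (auto simp: ennreal_eq_0_iff)
      next
        assume "AE x in L. x \<notin> A"
        then show "AE x in L. x \<in> A \<longrightarrow> ennreal (f x) = 0"
          by eventually_elim simp
      qed
      then show ?thesis
        by (subst null_sets_density_iff) (use AE_iff_null_sets[of A L] in auto)
    qed
    then show "null_sets (density L (\<lambda>x. ennreal (f x))) = null_sets L" by blast
  qed
  with sf show ?thesis
    by (auto simp: bayes_densities_def bayes_measures_def)
qed

lemma bayes_measures_density:
  assumes "finite_measure L" "\<mu> \<in> bayes_measures L"
  shows "\<exists>f\<in>bayes_densities L. \<mu> = density L (\<lambda>x. ennreal (f x))"
proof -
  interpret finite_measure L by fact
  define f where "f x = enn2real (RN_deriv L \<mu> x)" for x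
  have \<mu>: "sets \<mu> = sets L" "sigma_finite_measure \<mu>" "absolutely_continuous L \<mu>"
    using assms(2) by (auto simp: bayes_measures_def absolutely_continuous_def)
  have "AE x in L. RN_deriv L \<mu> x = ennreal (f x)"
    using RN_deriv_finite[OF \<mu>(2,3,1)] by eventually_elim (simp add: f_def less_top)
  then have "density L (RN_deriv L \<mu>) = density L (\<lambda>x. ennreal (f x))"
    by (intro density_cong) (auto simp: f_def)
  moreover have "f \<in> borel_measurable L" unfolding f_def by measurable
  ultimately show ?thesis
    using assms(2) density_RN_deriv[OF \<mu>(3,1)] by (auto simp: bayes_densities_def)
qed

lemma equiv_bayes_prop: "equiv (bayes_densities L) (bayes_prop L)"
proof (rule equivI)
  show "refl_on (bayes_densities L) (bayes_prop L)"
    by (auto simp: refl_on_def bayes_prop_def intro!: exI[of _ 1])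
  show "bayes_prop L \<subseteq> bayes_densities L \<times> bayes_densities L"
    by (auto simp: bayes_prop_def)
  show "sym (bayes_prop L)"
  proof (rule symI)
    fix f g assume "(f, g) \<in> bayes_prop L"
    then obtain c where c: "c > 0" "AE x in L. f x = c * g x"
      "f \<in> bayes_densities L" "g \<in> bayes_densities L" by (auto simp: bayes_prop_def)
    from c(2) have "AE x in L. g x = (1 / c) * f x"
      by eventually_elim (use c(1) in auto)
    with c show "(g, f) \<in> bayes_prop L"
      by (auto simp: bayes_prop_def intro!: exI[of _ "1 / c"])
  qed
  show "trans (bayes_prop L)"
  proof (rule transI)
    fix f g h assume "(f, g) \<in> bayes_prop L" "(g, h) \<in> bayes_prop L"
    then obtain c c' where c: "c > 0" "AE x in L. f x = c * g x"
      "c' > 0" "AE x in L. g x = c' * h x"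
      "f \<in> bayes_densities L" "h \<in> bayes_densities L" by (auto simp: bayes_prop_def)
    from c(2,4) have "AE x in L. f x = (c * c') * h x"
      by eventually_elim auto
    with c show "(f, h) \<in> bayes_prop L"
      by (auto simp: bayes_prop_def intro!: exI[of _ "c * c'"])
  qed
qed

lemma bayes_prop_mult:
  assumes "finite_measure L" "(f, f') \<in> bayes_prop L" "(g, g') \<in> bayes_prop L"
  shows "((\<lambda>x. f x * g x), (\<lambda>x. f' x * g' x)) \<in> bayes_prop L"
proof -
  note iff = bayes_densities_iff[OF assms(1)]
  obtain c c' where c: "c > 0" "AE x in L. f x = c * f' x" "c' > 0" "AE x in L. g x = c' * g' x"
    using assms by (auto simp: bayes_prop_def)
  from c(2,4) have "AE x in L. f x * g x = (c * c') * (f' x * g' x)"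
    by eventually_elim auto
  moreover have "(\<lambda>x. f x * g x) \<in> bayes_densities L \<and> (\<lambda>x. f' x * g' x) \<in> bayes_densities L"
    using assms(2,3) unfolding bayes_prop_def iff by auto
  ultimately show ?thesis
    using c(1,3) by (auto simp: bayes_prop_def intro!: exI[of _ "c * c'"])
qed

lemma bayes_prop_powr:
  assumes "finite_measure L" "(f, g) \<in> bayes_prop L"
  shows "((\<lambda>x. f x powr \<alpha>), (\<lambda>x. g x powr \<alpha>)) \<in> bayes_prop L"
proof -
  note iff = bayes_densities_iff[OF assms(1)]
  obtain c where c: "c > 0" "AE x in L. f x = c * g x" "AE x in L. 0 < f x" "AE x in L. 0 < g x"
    using assms by (auto simp: bayes_prop_def iff)
  from c(2-4) have "AE x in L. f x powr \<alpha> = c powr \<alpha> * g x powr \<alpha>"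
    by eventually_elim (use c(1) in \<open>auto simp: powr_mult\<close>)
  moreover have "(\<lambda>x. f x powr \<alpha>) \<in> bayes_densities L \<and> (\<lambda>x. g x powr \<alpha>) \<in> bayes_densities L"
    using assms(2) unfolding bayes_prop_def iff by auto
  ultimately show ?thesis
    using c(1) by (auto simp: bayes_prop_def intro!: exI[of _ "c powr \<alpha>"])
qed

lemma bayes_add_class:
  assumes "finite_measure L" "f \<in> bayes_densities L" "g \<in> bayes_densities L"
  shows "bayes_prop L `` {f} \<oplus>\<^bsub>bayes_space L\<^esub> bayes_prop L `` {g} =
         bayes_prop L `` {\<lambda>x. f x * g x}"
proof -
  have "congruent2 (bayes_prop L) (bayes_prop L) (\<lambda>f g. bayes_prop L `` {\<lambda>x. f x * g x})"
    by (auto simp: congruent2_def intro!: equiv_class_eq[OF equiv_bayes_prop] bayes_prop_mult assms)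
  from UN_equiv_class2[OF equiv_bayes_prop equiv_bayes_prop this assms(2,3)]
  show ?thesis by (simp add: bayes_space_def)
qed

lemma bayes_smult_class:
  assumes "finite_measure L" "f \<in> bayes_densities L"
  shows "\<alpha> \<odot>\<^bsub>bayes_space L\<^esub> bayes_prop L `` {f} = bayes_prop L `` {\<lambda>x. f x powr \<alpha>}"
proof -
  have "congruent (bayes_prop L) (\<lambda>f. bayes_prop L `` {\<lambda>x. f x powr \<alpha>})"
    by (auto simp: congruent_def intro!: equiv_class_eq[OF equiv_bayes_prop] bayes_prop_powr assms)
  from UN_equiv_class[OF equiv_bayes_prop this assms(2)]
  show ?thesis by (simp add: bayes_space_def)
qed

theorem module_bayes_space:
  assumes fin: "finite_measure L"
  shows "module \<lparr>carrier = UNIV, monoid.mult = (*), one = 1, zero = 0, add = (+)\<rparr> (bayes_space L)"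
    (is "module ?R ?B")
proof -
  note iff = bayes_densities_iff[OF fin]
  note addc = bayes_add_class[OF fin] and smc = bayes_smult_class[OF fin]
  let ?c = "\<lambda>f. bayes_prop L `` {f}"
  have mem: "?c f \<in> carrier ?B" if "f \<in> bayes_densities L" for f
    using that by (auto simp: bayes_space_def intro: quotientI)
  have rep: "\<exists>f\<in>bayes_densities L. F = ?c f" if "F \<in> carrier ?B" for F
    using that by (auto simp: bayes_space_def elim!: quotientE)
  have dm: "(\<lambda>x. f x * g x) \<in> bayes_densities L"
    if "f \<in> bayes_densities L" "g \<in> bayes_densities L" for f g
    using that unfolding iff by auto
  have dp: "(\<lambda>x. f x powr \<alpha>) \<in> bayes_densities L" if "f \<in> bayes_densities L" for f \<alpha>
    using that unfolding iff by auto
  have d1: "(\<lambda>x. 1) \<in> bayes_densities L" by (simp add: iff)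
  have zero: "\<zero>\<^bsub>?B\<^esub> = ?c (\<lambda>x. 1)" by (simp add: bayes_space_def)
  have eqI: "?c f = ?c g"
    if "f \<in> bayes_densities L" "g \<in> bayes_densities L" "AE x in L. f x = g x" for f g
    using that by (intro equiv_class_eq[OF equiv_bayes_prop])
      (auto simp: bayes_prop_def intro!: exI[of _ 1])
  have pos: "AE x in L. 0 < f x" if "f \<in> bayes_densities L" for f
    using that by (simp add: iff)
  show ?thesis
  proof (rule moduleI)
    show "cring ?R"
      by (rule cringI; (rule abelian_groupI comm_monoidI)?)
        (auto simp: algebra_simps intro: exI[of _ "- _"])
  next
    show "abelian_group ?B"
    proof (rule abelian_groupI)
      fix F G assume "F \<in> carrier ?B" "G \<in> carrier ?B"
      then show "F \<oplus>\<^bsub>?B\<^esub> G \<in> carrier ?B"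
        using rep[of F] rep[of G] by (auto simp: addc intro!: mem dm)
    next
      fix F G assume "F \<in> carrier ?B" "G \<in> carrier ?B"
      then show "F \<oplus>\<^bsub>?B\<^esub> G = G \<oplus>\<^bsub>?B\<^esub> F"
        using rep[of F] rep[of G] by (auto simp: addc mult.commute)
    next
      fix F G H assume "F \<in> carrier ?B" "G \<in> carrier ?B" "H \<in> carrier ?B"
      then show "F \<oplus>\<^bsub>?B\<^esub> G \<oplus>\<^bsub>?B\<^esub> H = F \<oplus>\<^bsub>?B\<^esub> (G \<oplus>\<^bsub>?B\<^esub> H)"
        using rep[of F] rep[of G] rep[of H] by (auto simp: addc dm mult.assoc)
    next
      show "\<zero>\<^bsub>?B\<^esub> \<in> carrier ?B" by (simp add: zero mem d1)
    next
      fix F assume "F \<in> carrier ?B"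
      then show "\<zero>\<^bsub>?B\<^esub> \<oplus>\<^bsub>?B\<^esub> F = F"
        using rep[of F] by (auto simp: zero addc d1)
    next
      fix F assume "F \<in> carrier ?B"
      then obtain f where f: "f \<in> bayes_densities L" "F = ?c f" using rep by blast
      have "?c (\<lambda>x. f x powr (-1) * f x) = ?c (\<lambda>x. 1)"
      proof (rule eqI)
        show "AE x in L. f x powr (-1) * f x = 1"
          using pos[OF f(1)] by eventually_elim (simp add: powr_minus)
      qed (intro dm dp d1 f)+
      then have "?c (\<lambda>x. f x powr (-1)) \<oplus>\<^bsub>?B\<^esub> F = \<zero>\<^bsub>?B\<^esub>"
        by (simp only: f(2) zero addc[OF dp[OF f(1)] f(1)])
      then show "\<exists>G\<in>carrier ?B. G \<oplus>\<^bsub>?B\<^esub> F = \<zero>\<^bsub>?B\<^esub>"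
        using mem[OF dp[OF f(1)]] by blast
    qed
  next
    fix \<alpha> F assume "F \<in> carrier ?B"
    then show "\<alpha> \<odot>\<^bsub>?B\<^esub> F \<in> carrier ?B"
      using rep[of F] by (auto simp: smc intro!: mem dp)
  next
    fix \<alpha> \<beta> F assume "F \<in> carrier ?B"
    then show "(\<alpha> \<oplus>\<^bsub>?R\<^esub> \<beta>) \<odot>\<^bsub>?B\<^esub> F = \<alpha> \<odot>\<^bsub>?B\<^esub> F \<oplus>\<^bsub>?B\<^esub> \<beta> \<odot>\<^bsub>?B\<^esub> F"
      using rep[of F] by (auto simp: smc addc dp powr_add)
  next
    fix \<alpha> F G assume "F \<in> carrier ?B" "G \<in> carrier ?B"
    then obtain f g where fg: "f \<in> bayes_densities L" "F = ?c f" "g \<in> bayes_densities L" "G = ?c g"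
      using rep by meson
    have "?c (\<lambda>x. (f x * g x) powr \<alpha>) = ?c (\<lambda>x. f x powr \<alpha> * g x powr \<alpha>)"
    proof (rule eqI)
      show "AE x in L. (f x * g x) powr \<alpha> = f x powr \<alpha> * g x powr \<alpha>"
        using pos[OF fg(1)] pos[OF fg(3)] by eventually_elim (simp add: powr_mult)
    qed (auto intro!: dm dp fg)
    then show "\<alpha> \<odot>\<^bsub>?B\<^esub> (F \<oplus>\<^bsub>?B\<^esub> G) = \<alpha> \<odot>\<^bsub>?B\<^esub> F \<oplus>\<^bsub>?B\<^esub> \<alpha> \<odot>\<^bsub>?B\<^esub> G"
      by (simp add: fg smc addc dp dm)
  next
    fix \<alpha> \<beta> F assume "F \<in> carrier ?B"
    then show "(\<alpha> \<otimes>\<^bsub>?R\<^esub> \<beta>) \<odot>\<^bsub>?B\<^esub> F = \<alpha> \<odot>\<^bsub>?B\<^esub> (\<beta> \<odot>\<^bsub>?B\<^esub> F)"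
      using rep[of F] by (auto simp: smc dp powr_powr mult.commute)
  next
    fix F assume "F \<in> carrier ?B"
    then obtain f where f: "f \<in> bayes_densities L" "F = ?c f" using rep by blast
    have "?c (\<lambda>x. f x powr 1) = ?c f"
    proof (rule eqI)
      show "AE x in L. f x powr 1 = f x"
        using pos[OF f(1)] by eventually_elim simp
    qed (use f dp[OF f(1), of 1] in auto)
    then show "\<one>\<^bsub>?R\<^esub> \<odot>\<^bsub>?B\<^esub> F = F"
      by (simp add: f smc)
  qed
qed

end

theory Submission
  imports Defs
begin

text \<open>
  Taking logarithms turns the Bayes space into a function space: \<open>\<phi> \<mapsto> [exp \<phi>]\<close>
  (\<^term>\<open>exp_class\<close>) sends sums to perturbations and scalar multiples to powers, and every class
  is of this form. If the class \<open>F\<close> has a representative \<open>f\<close> with integrable logarithm, its geometric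
  margins are the classes \<open>[exp (G J)]\<close>, where \<open>G J\<close> is the arithmetic mean of \<open>ln f\<close> over the
  coordinates outside \<open>J\<close>. Both sides of the decomposition are thus images of real functions, and
  they agree once
  \[ \sum_{i} G_{\{i\}} + \sum_{|I| \ge 2} \sum_{\emptyset \ne J \subseteq I} (-1)^{|I \setminus J|} G_J = G_D = \ln f \]
  holds at every point. This is Moebius inversion on the subset lattice
  (\<open>sum_singletons_plus_interactions\<close>) and holds for arbitrary numbers \<open>G J\<close>.

  Analysis enters in one place only, the claim that the margin of \<open>F\<close> is a single class
  (\<open>geo_margin_eq_exp_class\<close>). Another representative has logarithm \<open>ln f + const\<close> almost
  everywhere. By Fubini this persists on almost every fibre, where \<open>ln f\<close> is moreover integrable, so
  the fibre means also differ by a constant. Integrability cannot be dropped here, as the integral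
  of a non-integrable function is \<open>0\<close> by convention and does not react to adding a constant. It
  follows from the square integrability of \<open>ln f\<close> because the reference measure is finite.
\<close>

section \<open>Moebius inversion over non-empty subsets\<close>

text \<open>The inner alternating sums are the Moebius inverse of \<open>g\<close>, so summing them up gives \<open>g\<close> back.
  Leaving out the empty set amounts to giving \<open>g\<close> the value \<open>0\<close> there; this is compatible with
  the outer sum since the empty set has no non-empty subset.\<close>

lemma sum_alternating_nonempty_subsets:
  fixes g :: "'i set \<Rightarrow> real"
  assumes "finite D" "D \<noteq> {}"
  shows "(\<Sum>I | I \<subseteq> D \<and> I \<noteq> {}. \<Sum>J | J \<subseteq> I \<and> J \<noteq> {}. (-1) ^ card (I - J) * g J) = g D"
proof -
  define h where "h J = (if J = {} then 0 else g J)" for J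
  have inner: "(-1) ^ card I * (\<Sum>J\<in>Pow I. (-1) ^ card J * h J) =
               (\<Sum>J | J \<subseteq> I \<and> J \<noteq> {}. (-1) ^ card (I - J) * g J)" if "I \<subseteq> D" for I
  proof -
    have fin: "finite I" using that \<open>finite D\<close> finite_subset by blast
    have drop: "(\<Sum>J\<in>Pow I. (-1) ^ card J * h J) = (\<Sum>J | J \<subseteq> I \<and> J \<noteq> {}. (-1) ^ card J * g J)"
      using fin by (intro sum.mono_neutral_cong_right) (auto simp: h_def)
    \<comment> \<open>The sign of the symmetric inversion formula is \<open>(-1) ^ (card I + card J)\<close>, which has the
      same parity as \<open>card (I - J)\<close>.\<close>
    have sign: "(-1) ^ card I * ((-1) ^ card J * g J) = (-1) ^ card (I - J) * g J"
      if "J \<subseteq> I" for J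
    proof -
      have "card I = card (I - J) + card J"
        using that fin by (metis add.commute card_Diff_subset card_mono finite_subset
            le_add_diff_inverse)
      then show ?thesis by (simp add: power_add)
    qed
    show ?thesis
      unfolding drop sum_distrib_left by (intro sum.cong refl sign) auto
  qed
  have "g D = h D" using assms by (simp add: h_def)
  also have "\<dots> = (\<Sum>I\<in>Pow D. (-1) ^ card I * (\<Sum>J\<in>Pow I. (-1) ^ card J * h J))"
    by (rule inclusion_exclusion_symmetric) (simp_all add: assms)
  also have "\<dots> = (\<Sum>I\<in>Pow D. \<Sum>J | J \<subseteq> I \<and> J \<noteq> {}. (-1) ^ card (I - J) * g J)"
    by (intro sum.cong refl inner) auto
  also have "\<dots> = (\<Sum>I | I \<subseteq> D \<and> I \<noteq> {}. \<Sum>J | J \<subseteq> I \<and> J \<noteq> {}. (-1) ^ card (I - J) * g J)"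
    using assms(1) by (intro sum.mono_neutral_right) (auto intro!: sum.neutral)
  finally show ?thesis by simp
qed

text \<open>A singleton has itself as its only non-empty subset, so its alternating sum is \<open>g {i}\<close>. In the
  statistical reading, the interaction part of order one is the margin itself, which explains why
  the independence part can be split off in this form.\<close>

lemma sum_singletons_plus_interactions:
  fixes g :: "'i set \<Rightarrow> real"
  assumes "finite D" "D \<noteq> {}"
  shows "(\<Sum>i\<in>D. g {i}) +
         (\<Sum>I | I \<subseteq> D \<and> card I \<ge> 2. \<Sum>J | J \<subseteq> I \<and> J \<noteq> {}. (-1) ^ card (I - J) * g J) = g D"
proof -
  define a where "a I = (\<Sum>J | J \<subseteq> I \<and> J \<noteq> {}. (-1) ^ card (I - J) * g J)" for I
  have a1: "a {i} = g {i}" for i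
  proof -
    have "{J. J \<subseteq> {i} \<and> J \<noteq> {}} = {{i}}" by auto
    then show ?thesis by (simp add: a_def)
  qed
  have split: "{I. I \<subseteq> D \<and> I \<noteq> {}} = (\<lambda>i. {i}) ` D \<union> {I. I \<subseteq> D \<and> card I \<ge> 2}"
  proof (intro equalityI subsetI)
    fix I assume I: "I \<in> {I. I \<subseteq> D \<and> I \<noteq> {}}"
    then have "card I \<noteq> 0" using assms(1) finite_subset by fastforce
    then have "card I = 1 \<or> card I \<ge> 2" by linarith
    then show "I \<in> (\<lambda>i. {i}) ` D \<union> {I. I \<subseteq> D \<and> card I \<ge> 2}"
    proof
      assume "card I = 1"
      then obtain i where "I = {i}" by (rule card_1_singletonE)
      then show ?thesis using I by auto
    qed (use I in auto)
  qed auto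
  have "sum a {I. I \<subseteq> D \<and> I \<noteq> {}} =
        sum a ((\<lambda>i. {i}) ` D) + sum a {I. I \<subseteq> D \<and> card I \<ge> 2}"
    unfolding split using assms(1) by (intro sum.union_disjoint) auto
  also have "sum a ((\<lambda>i. {i}) ` D) = (\<Sum>i\<in>D. g {i})"
    by (subst sum.reindex) (auto simp: a1)
  finally show ?thesis
    using sum_alternating_nonempty_subsets[OF assms, of g] by (simp add: a_def)
qed

section \<open>The logarithm as a linear coordinate on the Bayes space\<close>

definition exp_class :: "'a measure \<Rightarrow> ('a \<Rightarrow> real) \<Rightarrow> ('a \<Rightarrow> real) set" where
  "exp_class L \<phi> = bayes_prop L `` {\<lambda>x. exp (\<phi> x)}"

lemma exp_in_bayes_densities:
  assumes "finite_measure L" "\<phi> \<in> borel_measurable L"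
  shows "(\<lambda>x. exp (\<phi> x)) \<in> bayes_densities L"
  using assms by (simp add: bayes_densities_iff)

lemma exp_class_closed:
  assumes "finite_measure L" "\<phi> \<in> borel_measurable L"
  shows "exp_class L \<phi> \<in> carrier (bayes_space L)"
  using exp_in_bayes_densities[OF assms]
  by (auto simp: exp_class_def bayes_space_def intro: quotientI)

lemma exp_class_add:
  assumes "finite_measure L" "\<phi> \<in> borel_measurable L" "\<psi> \<in> borel_measurable L"
  shows "exp_class L \<phi> \<oplus>\<^bsub>bayes_space L\<^esub> exp_class L \<psi> = exp_class L (\<lambda>x. \<phi> x + \<psi> x)"
  unfolding exp_class_def
  by (simp add: bayes_add_class exp_in_bayes_densities assms exp_add)

lemma exp_class_smult:
  assumes "finite_measure L" "\<phi> \<in> borel_measurable L"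
  shows "\<alpha> \<odot>\<^bsub>bayes_space L\<^esub> exp_class L \<phi> = exp_class L (\<lambda>x. \<alpha> * \<phi> x)"
  unfolding exp_class_def
  by (simp add: bayes_smult_class exp_in_bayes_densities assms exp_powr_real mult.commute)

text \<open>The finite sums of the Bayes space, taken with respect to its perturbation, are thereby reduced
  to pointwise sums of real functions.\<close>

lemma exp_class_finsum:
  assumes L: "finite_measure L" and "finite A"
    and "\<And>a. a \<in> A \<Longrightarrow> \<phi> a \<in> borel_measurable L"
  shows "(\<Oplus>\<^bsub>bayes_space L\<^esub> a\<in>A. exp_class L (\<phi> a)) = exp_class L (\<lambda>x. \<Sum>a\<in>A. \<phi> a x)"
proof -
  interpret module "\<lparr>carrier = UNIV, monoid.mult = (*), one = 1, zero = 0, add = (+)\<rparr>"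
    "bayes_space L"
    by (rule module_bayes_space[OF L])
  show ?thesis
    using assms(2,3)
  proof (induction A rule: finite_induct)
    case empty
    have "\<zero>\<^bsub>bayes_space L\<^esub> = exp_class L (\<lambda>x. 0)"
      by (simp add: exp_class_def bayes_space_def)
    then show ?case by simp
  next
    case (insert a A)
    then show ?case
      by (subst M.finsum_insert) (auto simp: exp_class_closed exp_class_add L)
  qed
qed

text \<open>Only almost every value of a density is positive, and \<open>exp (ln (f x)) = f x\<close> fails at the other
  points; the classes do not see this null set.\<close>

lemma bayes_class_eq_exp_class:
  assumes L: "finite_measure L" and f: "f \<in> bayes_densities L"
  shows "bayes_prop L `` {f} = exp_class L (\<lambda>x. ln (f x))"
proof -
  have f': "f \<in> borel_measurable L" "AE x in L. 0 < f x"
    using f by (simp_all add: bayes_densities_iff[OF L])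
  have "AE x in L. f x = 1 * exp (ln (f x))"
    using f'(2) by eventually_elim simp
  then show ?thesis
    unfolding exp_class_def using f f'(1)
    by (intro equiv_class_eq[OF equiv_bayes_prop])
      (auto simp: bayes_prop_def intro!: exp_in_bayes_densities L exI[of _ 1])
qed

section \<open>Fubini over a finite product indexed by a set\<close>

text \<open>The theory of products of sigma-finite measures asks for a condition at every index, including
  those outside \<open>D\<close>, where nothing is known about the family. The measures there do not influence
  the product over a subset of \<open>D\<close> and can be replaced by zero measures.\<close>

lemma PiM_subset_extend:
  assumes "\<forall>i\<in>D. finite_measure (lam i)"
  obtains lam' where "product_sigma_finite lam'" "\<And>i. finite_measure (lam' i)"
    "\<And>J. J \<subseteq> D \<Longrightarrow> PiM J lam = PiM J lam'"
proof
  define lam' where "lam' i = (if i \<in> D then lam i else count_space {})" for i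
  show fin: "finite_measure (lam' i)" for i
    using assms by (auto simp: lam'_def intro: finite_measure_count_space)
  show "product_sigma_finite lam'"
    using fin by (simp add: product_sigma_finite_def finite_measure_def)
  show "PiM J lam = PiM J lam'" if "J \<subseteq> D" for J
    using that by (intro PiM_cong) (auto simp: lam'_def)
qed

lemma finite_measure_PiM_subset:
  assumes "finite D" "\<forall>i\<in>D. finite_measure (lam i)" "J \<subseteq> D"
  shows "finite_measure (PiM J lam)"
proof -
  obtain lam' where lam': "product_sigma_finite lam'" "\<And>i. finite_measure (lam' i)"
    "\<And>J. J \<subseteq> D \<Longrightarrow> PiM J lam = PiM J lam'"
    using PiM_subset_extend[OF assms(2)] by blast
  have "finite J" using assms finite_subset by blast
  then have "emeasure (PiM J lam') (space (PiM J lam')) = (\<Prod>i\<in>J. emeasure (lam' i) (space (lam' i)))"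
    by (simp add: space_PiM product_sigma_finite.emeasure_PiM[OF lam'(1)])
  also have "\<dots> \<noteq> \<infinity>"
    using lam'(2) by (simp add: ennreal_prod_eq_top finite_measure.emeasure_finite)
  finally have "finite_measure (PiM J lam')" by (intro finite_measureI) auto
  then show ?thesis using lam'(3)[OF assms(3)] by simp
qed

lemma distr_merge_complement:
  assumes "finite D" "\<forall>i\<in>D. finite_measure (lam i)" "J \<subseteq> D"
  shows "distr (PiM J lam \<Otimes>\<^sub>M PiM (D - J) lam) (PiM D lam) (merge J (D - J)) = PiM D lam"
proof -
  obtain lam' where lam': "product_sigma_finite lam'" "\<And>i. finite_measure (lam' i)"
    "\<And>J. J \<subseteq> D \<Longrightarrow> PiM J lam = PiM J lam'"
    using PiM_subset_extend[OF assms(2)] by blast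
  have "J \<union> (D - J) = D" "finite J" "finite (D - J)"
    using assms finite_subset by auto
  then show ?thesis
    using product_sigma_finite.distr_merge[OF lam'(1), of J "D - J"] assms(3)
    by (simp add: lam'(3))
qed

lemma measurable_merge_complement:
  assumes "J \<subseteq> D"
  shows "merge J (D - J) \<in> PiM J lam \<Otimes>\<^sub>M PiM (D - J) lam \<rightarrow>\<^sub>M PiM D lam"
proof -
  have "J \<union> (D - J) = D" using assms by auto
  then show ?thesis using measurable_merge[of J "D - J" lam] by simp
qed

text \<open>A null set in the coordinates \<open>J\<close> gives a null cylinder in all coordinates. Properties that
  Fubini yields for almost every \<open>J\<close>-fibre can therefore be stated for almost every point of the full
  product, which is where the Bayes space of the decomposition lives.\<close>

lemma AE_PiM_restrict:
  assumes D: "finite D" "\<forall>i\<in>D. finite_measure (lam i)" and J: "J \<subseteq> D"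
    and P: "AE x in PiM J lam. P x"
  shows "AE x in PiM D lam. P (restrict x J)"
proof -
  interpret J: finite_measure "PiM J lam" by (rule finite_measure_PiM_subset[OF D J])
  interpret K: finite_measure "PiM (D - J) lam" by (rule finite_measure_PiM_subset[OF D]) auto
  interpret pair_sigma_finite "PiM J lam" "PiM (D - J) lam" ..
  note [measurable] = measurable_merge_complement[OF J, of lam]
  have r[measurable]: "(\<lambda>x. restrict x J) \<in> PiM D lam \<rightarrow>\<^sub>M PiM J lam"
    by (rule measurable_restrict_subset[OF J])
  obtain N where N: "N \<in> null_sets (PiM J lam)" "{x \<in> space (PiM J lam). \<not> P x} \<subseteq> N"
    using P by (auto simp: eventually_ae_filter)
  have [measurable]: "N \<in> sets (PiM J lam)" using N by auto
  have "AE x in PiM J lam. x \<notin> N" using N(1) by (rule AE_not_in)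
  then have "AE x in PiM J lam. AE y in PiM (D - J) lam. fst (x, y) \<notin> N"
    by eventually_elim simp
  then have "AE z in PiM J lam \<Otimes>\<^sub>M PiM (D - J) lam. fst z \<notin> N"
    by (intro AE_pair_measure) measurable
  then have "AE z in PiM J lam \<Otimes>\<^sub>M PiM (D - J) lam. restrict (merge J (D - J) z) J \<notin> N"
    using AE_space
    by eventually_elim (auto simp: space_pair_measure space_PiM PiE_restrict)
  then have "AE x in distr (PiM J lam \<Otimes>\<^sub>M PiM (D - J) lam) (PiM D lam) (merge J (D - J)).
      restrict x J \<notin> N"
    by (subst AE_distr_iff) measurable
  then have "AE x in PiM D lam. restrict x J \<notin> N"
    unfolding distr_merge_complement[OF D J] .
  then show ?thesis
    using AE_space
    by eventually_elim (use N(2) measurable_space[OF r] in blast)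
qed

section \<open>Geometric margins on the logarithmic scale\<close>

text \<open>The case distinction mirrors the one for \<^const>\<open>geo_margin_density\<close>. The value at \<open>x\<close> depends
  on the coordinates of \<open>x\<close> in \<open>J\<close> only, but it is kept as a function on the full product so that
  margins over different \<open>J\<close> can be added.\<close>

definition log_margin ::
  "'i set \<Rightarrow> ('i \<Rightarrow> 'a measure) \<Rightarrow> 'i set \<Rightarrow> (('i \<Rightarrow> 'a) \<Rightarrow> real) \<Rightarrow> ('i \<Rightarrow> 'a) \<Rightarrow> real" where
  "log_margin D lam J \<phi> x =
     (if J = D then \<phi> x
      else 1 / measure (PiM (D - J) lam) (space (PiM (D - J) lam)) *
           (\<integral>y. \<phi> (merge J (D - J) (x, y)) \<partial>PiM (D - J) lam))"

lemma borel_measurable_log_margin: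
  assumes D: "finite D" "\<forall>i\<in>D. finite_measure (lam i)" and J: "J \<subseteq> D"
    and [measurable]: "\<phi> \<in> borel_measurable (PiM D lam)"
  shows "log_margin D lam J \<phi> \<in> borel_measurable (PiM D lam)"
proof (cases "J = D")
  case True
  then have "log_margin D lam J \<phi> = \<phi>" by (auto simp: log_margin_def)
  then show ?thesis by simp
next
  case False
  interpret K: finite_measure "PiM (D - J) lam" by (rule finite_measure_PiM_subset[OF D]) auto
  note [measurable] = measurable_merge_complement[OF J, of lam]
  have [measurable]: "(\<lambda>x. restrict x J) \<in> PiM D lam \<rightarrow>\<^sub>M PiM J lam"
    by (rule measurable_restrict_subset[OF J])
  \<comment> \<open>Factoring through the restriction lands in the domain of the measurable merge map.\<close>
  have "(\<lambda>x. \<integral>y. \<phi> (merge J (D - J) (restrict x J, y)) \<partial>PiM (D - J) lam)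
        \<in> borel_measurable (PiM D lam)"
    by measurable
  then show ?thesis
    using False by (simp add: log_margin_def[abs_def])
qed

text \<open>This is the Fubini argument behind the well-definedness of margins: on almost every fibre the
  equation \<open>\<phi> = k + \<psi>\<close> holds almost everywhere and \<open>\<psi>\<close> is integrable, hence the integral splits
  into the integral of the constant \<open>k\<close> and that of \<open>\<psi>\<close>.\<close>

lemma log_margin_add_const_AE:
  assumes D: "finite D" "\<forall>i\<in>D. finite_measure (lam i)" and J: "J \<subseteq> D"
    and \<phi>[measurable]: "\<phi> \<in> borel_measurable (PiM D lam)"
    and \<psi>: "integrable (PiM D lam) \<psi>"
    and eq: "AE x in PiM D lam. \<phi> x = k + \<psi> x"
  shows "\<exists>c. AE x in PiM D lam. log_margin D lam J \<phi> x = c + log_margin D lam J \<psi> x"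
proof (cases "J = D")
  case True
  then show ?thesis using eq by (auto simp: log_margin_def)
next
  case False
  let ?J = "PiM J lam" and ?K = "PiM (D - J) lam" and ?m = "merge J (D - J)"
  interpret J: finite_measure ?J by (rule finite_measure_PiM_subset[OF D J])
  interpret K: finite_measure ?K by (rule finite_measure_PiM_subset[OF D]) auto
  interpret pair_sigma_finite ?J ?K ..
  note m[measurable] = measurable_merge_complement[OF J, of lam]
  note distr = distr_merge_complement[OF D J]
  define w where "w = 1 / measure ?K (space ?K)"
  have "integrable (?J \<Otimes>\<^sub>M ?K) (\<lambda>z. \<psi> (?m z))"
    using \<psi> distr by (intro integrable_distr[OF m]) simp
  then have int: "AE x in ?J. integrable ?K (\<lambda>y. \<psi> (?m (x, y)))"
    by (rule AE_integrable_fst')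
  have "AE z in ?J \<Otimes>\<^sub>M ?K. \<phi> (?m z) = k + \<psi> (?m z)"
    by (rule AE_distrD[OF m]) (unfold distr, rule eq)
  then have "AE x in ?J. AE y in ?K. \<phi> (?m (x, y)) = k + \<psi> (?m (x, y))"
    by (rule AE_pair)
  with int AE_space have "AE x in ?J. (\<integral>y. \<phi> (?m (x, y)) \<partial>?K) =
      k * measure ?K (space ?K) + (\<integral>y. \<psi> (?m (x, y)) \<partial>?K)"
  proof eventually_elim
    case (elim x)
    have [measurable]: "(\<lambda>y. ?m (x, y)) \<in> ?K \<rightarrow>\<^sub>M PiM D lam"
      using measurable_compose[OF measurable_Pair1'[OF elim(2)] m] .
    have [measurable]: "\<psi> \<in> borel_measurable (PiM D lam)" using \<psi> by simp
    have "(\<integral>y. \<phi> (?m (x, y)) \<partial>?K) = (\<integral>y. k + \<psi> (?m (x, y)) \<partial>?K)"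
      using elim(3) by (intro integral_cong_AE) measurable
    then show ?case
      using elim(1) by (simp add: mult.commute)
  qed
  then have "AE x in PiM D lam. (\<integral>y. \<phi> (?m (restrict x J, y)) \<partial>?K) =
      k * measure ?K (space ?K) + (\<integral>y. \<psi> (?m (restrict x J, y)) \<partial>?K)"
    by (rule AE_PiM_restrict[OF D J])
  then have "AE x in PiM D lam. log_margin D lam J \<phi> x =
      w * (k * measure ?K (space ?K)) + log_margin D lam J \<psi> x"
    by eventually_elim (use False in \<open>simp add: log_margin_def w_def add_divide_distrib\<close>)
  then show ?thesis by blast
qed

text \<open>By definition the margin of a class is a union over all its representatives. The union collapses
  to one class: a factor \<open>c\<close> between representatives is a summand \<open>ln c\<close> between their logarithms,
  and the previous lemma carries it over to the margins. Integrability is required of one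
  representative only and then passes to the others.\<close>

lemma geo_margin_eq_exp_class:
  assumes D: "finite D" "\<forall>i\<in>D. finite_measure (lam i)" and J: "J \<subseteq> D"
    and f: "f \<in> bayes_densities (PiM D lam)" "integrable (PiM D lam) (\<lambda>x. ln (f x))"
  shows "geo_margin D lam (bayes_prop (PiM D lam) `` {f}) J =
         exp_class (PiM D lam) (log_margin D lam J (\<lambda>x. ln (f x)))"
proof -
  let ?L = "PiM D lam"
  have L: "finite_measure ?L" by (rule finite_measure_PiM_subset[OF D]) auto
  note iff = bayes_densities_iff[OF L]
  have margin: "bayes_prop ?L `` {geo_margin_density D lam J g} =
      exp_class ?L (log_margin D lam J (\<lambda>x. ln (g x)))" if "g \<in> bayes_densities ?L" for g
  proof (cases "J = D")
    case True
    then show ?thesis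
      using bayes_class_eq_exp_class[OF L that]
      by (simp add: geo_margin_density_def log_margin_def[abs_def])
  next
    case False
    then show ?thesis
      by (simp add: geo_margin_density_def log_margin_def[abs_def] exp_class_def)
  qed
  have "bayes_prop ?L `` {geo_margin_density D lam J g} =
      exp_class ?L (log_margin D lam J (\<lambda>x. ln (f x)))" if g: "(f, g) \<in> bayes_prop ?L" for g
  proof -
    have "(g, f) \<in> bayes_prop ?L"
      using equiv_bayes_prop g by (meson equivE symD)
    then obtain c where c: "c > 0" "AE x in ?L. g x = c * f x" "g \<in> bayes_densities ?L"
      by (auto simp: bayes_prop_def)
    have "AE x in ?L. 0 < f x" using f(1) by (simp add: iff)
    with c(2) have "AE x in ?L. ln (g x) = ln c + ln (f x)"
      by eventually_elim (use c(1) in \<open>simp add: ln_mult\<close>)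
    from log_margin_add_const_AE[OF D J _ f(2) this] c(3) obtain k where
      "AE x in ?L. log_margin D lam J (\<lambda>x. ln (g x)) x = k + log_margin D lam J (\<lambda>x. ln (f x)) x"
      by (auto simp: iff)
    then have k: "AE x in ?L. exp (log_margin D lam J (\<lambda>x. ln (g x)) x) =
        exp k * exp (log_margin D lam J (\<lambda>x. ln (f x)) x)"
      by eventually_elim (simp add: exp_add)
    have "(\<lambda>x. exp (log_margin D lam J (\<lambda>x. ln (h x)) x)) \<in> bayes_densities ?L"
      if "h \<in> bayes_densities ?L" for h
      using that by (intro exp_in_bayes_densities L borel_measurable_log_margin D J)
        (auto simp: iff)
    then have "exp_class ?L (log_margin D lam J (\<lambda>x. ln (g x))) =
        exp_class ?L (log_margin D lam J (\<lambda>x. ln (f x)))"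
      unfolding exp_class_def using k f(1) c(3)
      by (intro equiv_class_eq[OF equiv_bayes_prop])
        (auto simp: bayes_prop_def intro!: exI[of _ "exp k"])
    then show ?thesis using margin[OF c(3)] by simp
  qed
  moreover have "(f, f) \<in> bayes_prop ?L"
    using f(1) by (auto simp: bayes_prop_def intro!: exI[of _ 1])
  ultimately show ?thesis
    unfolding geo_margin_def by auto
qed

text \<open>On a finite measure space square integrability implies integrability.\<close>

lemma bayes_space2_integrable_representative:
  assumes L: "finite_measure L" and F: "F \<in> bayes_space2 L"
  obtains f where "f \<in> bayes_densities L" "F = bayes_prop L `` {f}"
    "integrable L (\<lambda>x. ln (f x))"
proof -
  obtain f where f: "f \<in> F" "(\<integral>\<^sup>+ x. ennreal (\<bar>ln (f x)\<bar>\<^sup>2) \<partial>L) < \<infinity>"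
    and F': "F \<in> bayes_densities L // bayes_prop L"
    using F by (auto simp: bayes_space2_def bayes_space_def)
  obtain g where g: "F = bayes_prop L `` {g}" using F' by (rule quotientE)
  then have gf: "(g, f) \<in> bayes_prop L" using f(1) by simp
  then have cl: "F = bayes_prop L `` {f}"
    unfolding g by (rule equiv_class_eq[OF equiv_bayes_prop])
  have f': "f \<in> bayes_densities L" using gf by (simp add: bayes_prop_def)
  interpret finite_measure L by fact
  have [measurable]: "f \<in> borel_measurable L" using f' by (simp add: bayes_densities_iff[OF L])
  have "integrable L (\<lambda>x. (ln (f x))\<^sup>2)"
    using f(2) by (intro integrableI_bounded) auto
  then have "integrable L (\<lambda>x. ln (f x))"
    by (rule square_integrable_imp_integrable[rotated]) measurable
  then show ?thesis by (rule that[OF f' cl])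
qed

section \<open>The decomposition\<close>

theorem proposition4p2:
  fixes d :: nat
    and lam :: "nat \<Rightarrow> 'a measure"
    and F :: "((nat \<Rightarrow> 'a) \<Rightarrow> real) set"
  assumes "d \<ge> 2"
    and "\<And>i. i \<in> {1..d} \<Longrightarrow> finite_measure (lam i)"
    and "\<And>i. i \<in> {1..d} \<Longrightarrow> emeasure (lam i) (space (lam i)) \<noteq> 0"
    and "F \<in> bayes_space2 (PiM {1..d} lam)"
  shows "F = ind_part {1..d} lam F \<oplus>\<^bsub>bayes_space (PiM {1..d} lam)\<^esub>
             (\<Oplus>\<^bsub>bayes_space (PiM {1..d} lam)\<^esub> I\<in>{I. I \<subseteq> {1..d} \<and> card I \<ge> 2}.
                int_part {1..d} lam F I)"
proof -
  define D where "D = {1..d}"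
  let ?L = "PiM D lam" and ?B = "bayes_space (PiM D lam)"
  have D: "finite D" "\<forall>i\<in>D. finite_measure (lam i)" "D \<noteq> {}"
    using assms(1,2) by (auto simp: D_def)
  have L: "finite_measure ?L" by (rule finite_measure_PiM_subset[OF D(1,2)]) auto
  interpret module "\<lparr>carrier = UNIV, monoid.mult = (*), one = 1, zero = 0, add = (+)\<rparr>" ?B
    by (rule module_bayes_space[OF L])
  obtain f where f: "f \<in> bayes_densities ?L" "F = bayes_prop ?L `` {f}"
    "integrable ?L (\<lambda>x. ln (f x))"
    using bayes_space2_integrable_representative[OF L] assms(4) by (metis D_def)
  \<comment> \<open>All parts of the decomposition are now computed from the one representative \<open>f\<close>.\<close>
  define G where "G J = log_margin D lam J (\<lambda>x. ln (f x))" for J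
  have margin: "geo_margin D lam F J = exp_class ?L (G J)" if "J \<subseteq> D" for J
    unfolding f(2) G_def by (rule geo_margin_eq_exp_class[OF D(1,2) that f(1,3)])
  have G: "G J \<in> borel_measurable ?L" if "J \<subseteq> D" for J
    unfolding G_def using f(3) that D by (intro borel_measurable_log_margin) auto
  have GD: "G D = (\<lambda>x. ln (f x))" by (auto simp: G_def log_margin_def)
  define R where "R I x = (\<Sum>J | J \<subseteq> I \<and> J \<noteq> {}. (-1) ^ card (I - J) * G J x)" for I x
  have R: "R I \<in> borel_measurable ?L" if "I \<subseteq> D" for I
    unfolding R_def[abs_def] using that
    by (intro borel_measurable_sum borel_measurable_times borel_measurable_const G) auto
  have ind: "ind_part D lam F = exp_class ?L (\<lambda>x. \<Sum>i\<in>D. G {i} x)"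
  proof -
    have "ind_part D lam F = (\<Oplus>\<^bsub>?B\<^esub> i\<in>D. exp_class ?L (G {i}))"
      unfolding ind_part_def
      by (intro M.finsum_cong') (auto simp: margin G exp_class_closed[OF L])
    then show ?thesis by (simp add: exp_class_finsum L D G)
  qed
  have int: "int_part D lam F I = exp_class ?L (R I)" if I: "I \<subseteq> D" for I
  proof -
    have fin: "finite {J. J \<subseteq> I \<and> J \<noteq> {}}"
      using finite_subset[OF I D(1)] by simp
    have "int_part D lam F I =
        (\<Oplus>\<^bsub>?B\<^esub> J\<in>{J. J \<subseteq> I \<and> J \<noteq> {}}. exp_class ?L (\<lambda>x. (-1) ^ card (I - J) * G J x))"
      unfolding int_part_def
    proof (intro M.finsum_cong')
      show "(\<lambda>J. exp_class ?L (\<lambda>x. (-1) ^ card (I - J) * G J x))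
          \<in> {J. J \<subseteq> I \<and> J \<noteq> {}} \<rightarrow> carrier ?B"
        using I by (auto intro!: exp_class_closed L borel_measurable_times G)
    next
      fix J assume "J \<in> {J. J \<subseteq> I \<and> J \<noteq> {}}"
      then have "J \<subseteq> D" using I by auto
      then show "(-1) ^ card (I - J) \<odot>\<^bsub>?B\<^esub> geo_margin D lam F J =
          exp_class ?L (\<lambda>x. (-1) ^ card (I - J) * G J x)"
        by (simp add: margin exp_class_smult[OF L] G)
    qed simp
    also have "\<dots> = exp_class ?L (R I)"
      unfolding R_def[abs_def] using I
      by (intro exp_class_finsum L fin borel_measurable_times G) auto
    finally show ?thesis .
  qed
  have fin2: "finite {I. I \<subseteq> D \<and> card I \<ge> 2}" using D(1) by simp
  have "(\<Oplus>\<^bsub>?B\<^esub> I\<in>{I. I \<subseteq> D \<and> card I \<ge> 2}. int_part D lam F I) =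
      (\<Oplus>\<^bsub>?B\<^esub> I\<in>{I. I \<subseteq> D \<and> card I \<ge> 2}. exp_class ?L (R I))"
    by (intro M.finsum_cong') (auto simp: int R exp_class_closed[OF L])
  also have "\<dots> = exp_class ?L (\<lambda>x. \<Sum>I | I \<subseteq> D \<and> card I \<ge> 2. R I x)"
    by (intro exp_class_finsum L fin2 R) auto
  finally have inter: "(\<Oplus>\<^bsub>?B\<^esub> I\<in>{I. I \<subseteq> D \<and> card I \<ge> 2}. int_part D lam F I) =
      exp_class ?L (\<lambda>x. \<Sum>I | I \<subseteq> D \<and> card I \<ge> 2. R I x)" .
  have "ind_part D lam F \<oplus>\<^bsub>?B\<^esub>
      (\<Oplus>\<^bsub>?B\<^esub> I\<in>{I. I \<subseteq> D \<and> card I \<ge> 2}. int_part D lam F I) =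
      exp_class ?L (\<lambda>x. (\<Sum>i\<in>D. G {i} x) + (\<Sum>I | I \<subseteq> D \<and> card I \<ge> 2. R I x))"
    unfolding ind inter
    by (intro exp_class_add[OF L] borel_measurable_sum G R) auto
  also have "\<dots> = exp_class ?L (G D)"
    unfolding R_def by (intro arg_cong[where f = "exp_class ?L"] ext
        sum_singletons_plus_interactions[OF D(1,3), of "\<lambda>J. G J _"])
  also have "\<dots> = F"
    unfolding GD f(2) using bayes_class_eq_exp_class[OF L f(1)] by simp
  finally show ?thesis by (simp add: D_def)
qed

end
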